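(* Let $G=\{1,\dots,\sqrt{n}\}\times\{1,\dots,\sqrt{n}\}$ be the integer grid of size $\sqrt{n}\times\sqrt{n}$ (with $\sqrt n$ a positive integer). The number of prime $4$-holes of $G$ is $\Omega(n^2\log n/\log\log n)$.
   Context: A prime segment is a segment spanned by two points of $G$ containing no point of $G$ in its relative interior. A $k$-hole of $G$ is a simple polygon with exactly $k$ vertices, all in $G$, whose interior contains no point of $G$; it is a prime $k$-hole if all of its edges are prime segments. *)

theory Defs
  imports "HOL-Analysis.Analysis" "HOL-Library.Landau_Symbols"
begin

definition grid :: "nat \<Rightarrow> (real \<times> real) set" where
  "grid m = (\<lambda>(i, j). (real i, real j)) ` ({1..m} \<times> {1..m})"

definition prime_segment :: "(real \<times> real) set \<Rightarrow> real \<times> real \<Rightarrow> real \<times> real \<Rightarrow> bool" where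
  "prime_segment G a b \<longleftrightarrow>
     a \<in> G \<and> b \<in> G \<and> a \<noteq> b \<and> rel_interior (closed_segment a b) \<inter> G = {}"

text \<open>A closed polygon is given by the list of its vertices in cyclic order; indices are read
  modulo the length of the list.\<close>

definition cyc_nth :: "'a list \<Rightarrow> nat \<Rightarrow> 'a" where
  "cyc_nth vs i = vs ! (i mod length vs)"

definition edge :: "(real \<times> real) list \<Rightarrow> nat \<Rightarrow> (real \<times> real) set" where
  "edge vs i = closed_segment (cyc_nth vs i) (cyc_nth vs (Suc i))"

definition polygon_boundary :: "(real \<times> real) list \<Rightarrow> (real \<times> real) set" where
  "polygon_boundary vs = (\<Union>i<length vs. edge vs i)"

text \<open>Two distinct edges meet exactly in the endpoints they have in common. The angle at a vertex
  is never straight, so the number of vertices is determined by the polygon as a point set.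
  Polygons need not be convex.\<close>

definition simple_polygon :: "(real \<times> real) list \<Rightarrow> bool" where
  "simple_polygon vs \<longleftrightarrow>
     length vs \<ge> 3 \<and> distinct vs \<and>
     (\<forall>i<length vs. \<forall>j<length vs. i \<noteq> j \<longrightarrow>
        edge vs i \<inter> edge vs j =
          {cyc_nth vs i, cyc_nth vs (Suc i)} \<inter> {cyc_nth vs j, cyc_nth vs (Suc j)}) \<and>
     (\<forall>i<length vs.
        \<not> collinear {cyc_nth vs i, cyc_nth vs (Suc i), cyc_nth vs (Suc (Suc i))})"

definition is_hole :: "(real \<times> real) set \<Rightarrow> nat \<Rightarrow> (real \<times> real) list \<Rightarrow> bool" where
  "is_hole G k vs \<longleftrightarrow>
     simple_polygon vs \<and> length vs = k \<and> set vs \<subseteq> G \<and> inside (polygon_boundary vs) \<inter> G = {}"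

definition is_prime_hole :: "(real \<times> real) set \<Rightarrow> nat \<Rightarrow> (real \<times> real) list \<Rightarrow> bool" where
  "is_prime_hole G k vs \<longleftrightarrow>
     is_hole G k vs \<and> (\<forall>i<k. prime_segment G (cyc_nth vs i) (cyc_nth vs (Suc i)))"

text \<open>Vertex lists differing by a rotation or a reversal describe the same polygon, so holes are
  counted as point sets, each polygon being identified with its boundary curve. Different polygons
  on the same vertex set count separately.\<close>

definition prime_holes :: "(real \<times> real) set \<Rightarrow> nat \<Rightarrow> (real \<times> real) set set" where
  "prime_holes G k = polygon_boundary ` {vs. is_prime_hole G k vs}"

end

theory Submission
  imports Defs "HOL-Number_Theory.Totient" "HOL-Real_Asymp.Real_Asymp"
begin

text \<open>For a primitive vector \<open>v = (a, b)\<close> with \<open>1 \<le> b \<le> a\<close> choose \<open>w\<close> with \<open>cross v w = 1\<close>. The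
  triangles \<open>p, p + v, p + w + k v\<close> and \<open>p, p + v, p - w + l v\<close> are unimodular and lie on opposite sides
  of their common edge, so their union is a prime 4-hole as soon as no angle is straight; for
  \<open>k, l \<ge> 2\<close> it has a reflex vertex at \<open>p + v\<close>, and everything lies to the upper right of \<open>p\<close>. There
  are of order \<open>(m/a)\<^sup>2\<close> choices of \<open>(k, l)\<close> and \<open>m\<^sup>2\<close> choices of \<open>p\<close>, so the number of these holes is
  of order \<open>m\<^sup>4\<close> times the sum of \<open>totient a / a\<^sup>2\<close> over \<open>a\<close> up to a constant multiple of \<open>m\<close>. That
  sum is at least of order \<open>ln m\<close>, since its product with the convergent sum of the \<open>1 / g\<^sup>2\<close>
  dominates the harmonic sum. The grid points on the boundary, sorted by first coordinate, determine
  the hole, so it is counted once. This even gives \<open>m\<^sup>4 ln m\<close>, without the iterated logarithm.\<close>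

section \<open>Plane segments and the determinant of two vectors\<close>

definition cross :: "real \<times> real \<Rightarrow> real \<times> real \<Rightarrow> real" where
  "cross z w = fst z * snd w - snd z * fst w"

lemma cross_eq_0_if_closed_segment:
  assumes "z \<in> closed_segment r a"
  shows "cross (a - r) (z - r) = 0"
proof -
  obtain t where t: "z = (1 - t) *\<^sub>R r + t *\<^sub>R a"
    using assms by (auto simp: in_segment)
  show ?thesis by (simp add: t cross_def algebra_simps)
qed

text \<open>The map \<open>z \<mapsto> cross e (z - c)\<close> is affine along the segment.
  Vanishing at \<open>a\<close> but not at \<open>b\<close>, it has no zero on the segment other
  than \<open>a\<close>.\<close>

lemma closed_segment_eq_endpoint:
  assumes z: "z \<in> closed_segment a b" "cross e (z - c) = 0"
    and "cross e (a - c) = 0" "cross e (b - c) \<noteq> 0"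
  shows "z = a"
proof -
  obtain t where t: "z = (1 - t) *\<^sub>R a + t *\<^sub>R b"
    using z by (auto simp: in_segment)
  have "cross e (z - c) = (1 - t) * cross e (a - c) + t * cross e (b - c)"
    by (simp add: t cross_def algebra_simps)
  then have "t = 0" using assms by simp
  then show ?thesis by (simp add: t)
qed

lemma closed_segment_cross_nonneg:
  assumes "z \<in> closed_segment a b" "cross e (a - c) \<ge> 0" "cross e (b - c) \<ge> 0"
  shows "cross e (z - c) \<ge> 0"
proof -
  obtain t where t: "z = (1 - t) *\<^sub>R a + t *\<^sub>R b" "0 \<le> t" "t \<le> 1"
    using assms(1) by (auto simp: in_segment)
  have "cross e (z - c) = (1 - t) * cross e (a - c) + t * cross e (b - c)"
    by (simp add: t cross_def algebra_simps)
  then show ?thesis using assms t by simp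
qed

lemma closed_segments_Int_vertex:
  assumes "cross (a - r) (b - r) \<noteq> 0"
  shows "closed_segment r a \<inter> closed_segment r b = {r}"
proof -
  have "z = r" if "z \<in> closed_segment r a" "z \<in> closed_segment r b" for z
    using closed_segment_eq_endpoint[OF that(2) cross_eq_0_if_closed_segment[OF that(1)]] assms
    by (simp add: cross_def)
  then show ?thesis by auto
qed

text \<open>The line through \<open>p\<close> in direction \<open>e\<close> also passes through
  \<open>q\<close> and separates \<open>r\<close> from \<open>s\<close>. A common point would lie on
  this line, which the segments meet only at \<open>p\<close> and at \<open>q\<close>,
  respectively.\<close>

lemma closed_segments_disjoint:
  assumes "p \<noteq> q" "cross e (q - p) = 0" "cross e (r - p) > 0" "cross e (s - p) < 0"
  shows "closed_segment p r \<inter> closed_segment q s = {}"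
proof -
  have False if z: "z \<in> closed_segment p r" "z \<in> closed_segment q s" for z
  proof -
    have p0: "cross e (p - p) = 0" by (simp add: cross_def)
    have neg: "cross (- e) x = - cross e x" for x
      by (simp add: cross_def)
    have "cross e (z - p) \<ge> 0"
      using closed_segment_cross_nonneg[OF z(1), of e p] assms p0 by simp
    moreover have "cross (- e) (z - p) \<ge> 0"
      using closed_segment_cross_nonneg[OF z(2), of "- e" p] assms neg by simp
    ultimately have f0: "cross e (z - p) = 0" using neg by simp
    have "z = p" using closed_segment_eq_endpoint[OF z(1) f0] assms p0 by simp
    moreover have "z = q" using closed_segment_eq_endpoint[OF z(2) f0] assms by simp
    ultimately show False using assms by simp
  qed
  then show ?thesis by auto
qed

lemma not_collinear_if_cross:
  assumes "cross (b - a) (c - a) \<noteq> 0"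
  shows "\<not> collinear {a, b, c}"
proof
  assume "collinear {a, b, c}"
  then obtain u where u: "\<forall>x\<in>{a,b,c}. \<forall>y\<in>{a,b,c}. \<exists>t. x - y = t *\<^sub>R u"
    unfolding collinear_def by blast
  obtain s t where "b - a = s *\<^sub>R u" "c - a = t *\<^sub>R u" using u by blast
  then show False using assms by (simp add: cross_def)
qed

section \<open>Unimodularity: grid determinants are integers\<close>

lemma in_gridI:
  assumes "x = real i" "y = real j" "1 \<le> i" "i \<le> m" "1 \<le> j" "j \<le> m"
  shows "(x, y) \<in> grid m"
  using assms by (force simp: grid_def)

lemma cross_grid_Ints:
  assumes "a \<in> grid m" "b \<in> grid m" "c \<in> grid m" "d \<in> grid m"
  shows "cross (a - b) (c - d) \<in> \<int>"
  using assms by (auto simp: grid_def cross_def)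

text \<open>A grid point at parameter \<open>t\<close> strictly between 0 and 1 would yield a grid
  determinant of absolute value \<open>t\<close>, which is not an integer. The pair
  \<open>e\<close>, \<open>f\<close> is arbitrary, so that one diagonal can serve all four sides of
  a quadrilateral.\<close>

lemma prime_segment_if_cross:
  assumes G: "a \<in> grid m" "b \<in> grid m" "e \<in> grid m" "f \<in> grid m"
    and 1: "\<bar>cross (e - f) (b - a)\<bar> = 1"
  shows "prime_segment (grid m) a b"
proof -
  have ne: "a \<noteq> b" using 1 by (auto simp: cross_def)
  have False if z: "z \<in> open_segment a b" "z \<in> grid m" for z
  proof -
    obtain t where t: "z = (1 - t) *\<^sub>R a + t *\<^sub>R b" "0 < t" "t < 1"
      using z by (auto simp: in_segment)
    have "cross (e - f) (z - a) = t * cross (e - f) (b - a)"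
      by (simp add: t cross_def algebra_simps)
    then have "\<bar>cross (e - f) (z - a)\<bar> = t" using 1 t by (simp add: abs_mult)
    moreover have "\<bar>cross (e - f) (z - a)\<bar> \<in> \<int>"
      using cross_grid_Ints[OF G(3,4) z(2) G(1)] by (rule Ints_abs)
    ultimately obtain i :: int where "t = of_int i" by (metis Ints_cases)
    then show False using t by simp
  qed
  then show ?thesis using ne G by (auto simp: prime_segment_def rel_interior_closed_segment)
qed

text \<open>The barycentric coordinates of \<open>z\<close> with respect to \<open>q\<close> and
  \<open>r\<close> are, up to sign, determinants of grid vectors and hence integers. Being
  nonnegative with sum at most 1, they single out a vertex.\<close>

lemma unimodular_triangle_Int_grid:
  assumes G: "p \<in> grid m" "q \<in> grid m" "r \<in> grid m"
    and 1: "\<bar>cross (q - p) (r - p)\<bar> = 1"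
  shows "convex hull {p, q, r} \<inter> grid m \<subseteq> {p, q, r}"
proof
  fix z assume z: "z \<in> convex hull {p, q, r} \<inter> grid m"
  then obtain \<alpha> \<beta> \<gamma> where h: "z = \<alpha> *\<^sub>R p + \<beta> *\<^sub>R q + \<gamma> *\<^sub>R r" "0 \<le> \<alpha>" "0 \<le> \<beta>" "0 \<le> \<gamma>" "\<alpha> + \<beta> + \<gamma> = 1"
    by (auto simp: convex_hull_3)
  have \<alpha>: "\<alpha> = 1 - \<beta> - \<gamma>" using h by simp
  have "cross (q - p) (z - p) = \<gamma> * cross (q - p) (r - p)"
    "cross (z - p) (r - p) = \<beta> * cross (q - p) (r - p)"
    by (simp_all add: h(1) \<alpha> cross_def algebra_simps)
  then have "\<bar>cross (q - p) (z - p)\<bar> = \<gamma>" "\<bar>cross (z - p) (r - p)\<bar> = \<beta>"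
    using 1 h by (simp_all add: abs_mult)
  moreover have "\<bar>cross (q - p) (z - p)\<bar> \<in> \<int>" "\<bar>cross (z - p) (r - p)\<bar> \<in> \<int>"
    using z G by (auto intro!: Ints_abs cross_grid_Ints simp del: split_paired_All)
  ultimately obtain i j :: int where ij: "\<gamma> = of_int i" "\<beta> = of_int j" by (metis Ints_cases)
  have ij': "0 \<le> i" "0 \<le> j" "i + j \<le> 1"
    using h unfolding ij by linarith+
  then consider "i = 0" "j = 0" | "i = 1" "j = 0" | "i = 0" "j = 1" by linarith
  then show "z \<in> {p, q, r}" proof cases
    case 1
    then show ?thesis using h ij by simp
  next
    case 2
    then have "\<gamma> = 1" "\<beta> = 0" "\<alpha> = 0" using h(5) ij by simp_all
    then show ?thesis using h(1) by simp
  next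
    case 3
    then have "\<gamma> = 0" "\<beta> = 1" "\<alpha> = 0" using h(5) ij by simp_all
    then show ?thesis using h(1) by simp
  qed
qed

section \<open>Gluing two unimodular triangles to a prime 4-hole\<close>

text \<open>From a point \<open>x\<close> outside \<open>S\<close>, the ray pointing away from
  \<open>p\<close> never enters \<open>S\<close>, since otherwise the segment back to
  \<open>p\<close> would put \<open>x\<close> into \<open>S\<close>. The ray is unbounded and avoids
  \<open>B\<close>, so \<open>x\<close> is not inside \<open>B\<close>. Convexity would be too
  strong here: the quadrilaterals may have a reflex vertex.\<close>

lemma inside_subset_starlike:
  fixes B S :: "'a::euclidean_space set"
  assumes S: "\<And>y. y \<in> S \<Longrightarrow> closed_segment p y \<subseteq> S" and p: "p \<in> S" and BS: "B \<subseteq> S"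
  shows "inside B \<subseteq> S"
proof
  fix x assume x: "x \<in> inside B"
  show "x \<in> S"
  proof (rule ccontr)
    assume xS: "x \<notin> S"
    define R where "R = (\<lambda>t. p + t *\<^sub>R (x - p)) ` {1..}"
    have "p \<noteq> x" using p xS by auto
    have "R \<inter> S = {}"
    proof (rule ccontr)
      assume "R \<inter> S \<noteq> {}"
      then obtain t where t: "t \<ge> 1" "p + t *\<^sub>R (x - p) \<in> S" by (auto simp: R_def)
      have "x \<in> closed_segment p (p + t *\<^sub>R (x - p))"
        unfolding in_segment
        by (rule exI[of _ "1/t"]) (use t in \<open>auto simp: algebra_simps\<close>)
      then show False using S[OF t(2)] xS by auto
    qed
    moreover have "connected R" unfolding R_def
      by (intro connected_continuous_image continuous_intros) (auto simp: convex_connected)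
    moreover have "x \<in> R" unfolding R_def by (rule image_eqI[of _ _ 1]) auto
    ultimately have "R \<subseteq> connected_component_set (- B) x"
      using BS by (intro connected_component_maximal) auto
    then have "bounded R" using x by (auto simp: inside_def intro: bounded_subset)
    then obtain C where C: "\<And>y. y \<in> R \<Longrightarrow> norm y \<le> C" by (auto simp: bounded_iff)
    \<comment> \<open>Chosen so that the ray point has norm at least
      \<open>norm (x - p) + \<bar>C\<bar>\<close>, which exceeds \<open>C\<close>.\<close>
    define t where "t = 1 + (norm p + \<bar>C\<bar>) / norm (x - p)"
    have "t \<ge> 1" by (simp add: t_def)
    then have "norm (p + t *\<^sub>R (x - p)) \<le> C" by (intro C) (auto simp: R_def)
    moreover have "norm (t *\<^sub>R (x - p)) \<le> norm (p + t *\<^sub>R (x - p)) + norm p"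
      by (metis add_diff_cancel_left' norm_triangle_ineq4)
    moreover have "norm (t *\<^sub>R (x - p)) = norm (x - p) + norm p + \<bar>C\<bar>"
    proof -
      have "norm (t *\<^sub>R (x - p)) = t * norm (x - p)" using \<open>t \<ge> 1\<close> by simp
      also have "\<dots> = norm (x - p) + norm p + \<bar>C\<bar>"
      proof -
        have "(1 + c / n) * n = n + c" if "n \<noteq> 0" for c n :: real
          using that by (simp add: distrib_right)
        then show ?thesis using \<open>p \<noteq> x\<close> unfolding t_def by (simp add: add.assoc)
      qed
      finally show ?thesis .
    qed
    moreover have "norm (x - p) > 0" using \<open>p \<noteq> x\<close> by simp
    ultimately show False by linarith
  qed
qed

text \<open>The segment from \<open>p\<close> to \<open>q\<close> is the edge shared by the
  triangles, with \<open>r\<close> and \<open>s\<close> on opposite sides of its line. The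
  conditions \<open>p\<close> and \<open>q\<close> exclude straight angles at these two vertices; at
  \<open>r\<close> and \<open>s\<close> unimodularity does.\<close>

lemma is_prime_hole_quadrilateral:
  assumes G: "p \<in> grid m" "q \<in> grid m" "r \<in> grid m" "s \<in> grid m"
    and r: "cross (q - p) (r - p) = 1" and s: "cross (q - p) (s - p) = -1"
    and p: "cross (r - p) (s - p) \<noteq> 0" and q: "cross (r - q) (s - q) \<noteq> 0"
  shows "is_prime_hole (grid m) 4 [p, r, q, s]"
proof -
  let ?vs = "[p, r, q, s]"
  have nth: "cyc_nth ?vs 0 = p" "cyc_nth ?vs (Suc 0) = r" "cyc_nth ?vs (Suc (Suc 0)) = q"
    "cyc_nth ?vs (Suc (Suc (Suc 0))) = s" "cyc_nth ?vs (Suc (Suc (Suc (Suc 0)))) = p"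
    "cyc_nth ?vs (Suc (Suc (Suc (Suc (Suc 0))))) = r"
    by (simp_all add: cyc_nth_def)
  have all4: "(\<forall>i<4. P i) \<longleftrightarrow> P 0 \<and> P (Suc 0) \<and> P (Suc (Suc 0)) \<and> P (Suc (Suc (Suc 0)))" for P
    by (simp add: numeral_eq_Suc All_less_Suc) blast
  have distinct: "p \<noteq> r" "p \<noteq> q" "p \<noteq> s" "q \<noteq> r" "q \<noteq> s" "r \<noteq> s"
    using r s by (auto simp: cross_def)
  have adj: "cross (p - r) (q - r) \<noteq> 0" "cross (p - s) (q - s) \<noteq> 0"
    using r s by (simp_all add: cross_def algebra_simps)
  have e: "closed_segment r p \<inter> closed_segment r q = {r}" "closed_segment s p \<inter> closed_segment s q = {s}"
    "closed_segment p r \<inter> closed_segment p s = {p}" "closed_segment q r \<inter> closed_segment q s = {q}"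
    by (intro closed_segments_Int_vertex adj p q)+
  have "closed_segment p r \<inter> closed_segment q s = {}"
    by (rule closed_segments_disjoint[of _ _ "q - p"])
      (use distinct r s in \<open>simp_all add: cross_def algebra_simps\<close>)
  \<comment> \<open>Reversing the direction of the diagonal exchanges its two sides, so
    \<open>s\<close> is now on the positive one.\<close>
  moreover have "closed_segment p s \<inter> closed_segment q r = {}"
    by (rule closed_segments_disjoint[of _ _ "p - q"])
      (use distinct r s in \<open>simp_all add: cross_def algebra_simps\<close>)
  ultimately have disj: "closed_segment p r \<inter> closed_segment q s = {}" "closed_segment p s \<inter> closed_segment q r = {}"
    by auto
  have simple: "simple_polygon ?vs"
    unfolding simple_polygon_def
  proof (intro conjI)
    have "\<forall>i<4. \<forall>j<4. i \<noteq> j \<longrightarrow>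
        edge ?vs i \<inter> edge ?vs j =
          {cyc_nth ?vs i, cyc_nth ?vs (Suc i)} \<inter> {cyc_nth ?vs j, cyc_nth ?vs (Suc j)}"
      unfolding all4 edge_def nth
      using e disj distinct by (simp add: closed_segment_commute Int_commute)
    then show "\<forall>i<length ?vs. \<forall>j<length ?vs. i \<noteq> j \<longrightarrow>
        edge ?vs i \<inter> edge ?vs j =
          {cyc_nth ?vs i, cyc_nth ?vs (Suc i)} \<inter> {cyc_nth ?vs j, cyc_nth ?vs (Suc j)}"
      by simp
    have "\<not> collinear {p, r, q}" "\<not> collinear {r, q, s}" "\<not> collinear {q, s, p}" "\<not> collinear {s, p, r}"
      by (rule not_collinear_if_cross; use r s p q in \<open>simp add: cross_def algebra_simps\<close>)+
    then have "\<forall>i<4. \<not> collinear {cyc_nth ?vs i, cyc_nth ?vs (Suc i), cyc_nth ?vs (Suc (Suc i))}"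
      unfolding all4 nth by simp
    then show "\<forall>i<length ?vs. \<not> collinear {cyc_nth ?vs i, cyc_nth ?vs (Suc i), cyc_nth ?vs (Suc (Suc i))}"
      by simp
  qed (use distinct in auto)
  \<comment> \<open>Each side joins one of \<open>p\<close>, \<open>q\<close> to one of
    \<open>r\<close>, \<open>s\<close>, so its determinant with \<open>q - p\<close> is 1 or
    -1.\<close>
  have "\<forall>i<4. prime_segment (grid m) (cyc_nth ?vs i) (cyc_nth ?vs (Suc i))"
    unfolding all4 nth
    by (intro conjI prime_segment_if_cross[of _ _ _ q p] G;
        use r s in \<open>simp add: cross_def algebra_simps\<close>)
  moreover have "inside (polygon_boundary ?vs) \<inter> grid m = {}"
  proof -
    let ?T = "convex hull {p, q, r} \<union> convex hull {p, q, s}"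
    have B: "polygon_boundary ?vs = closed_segment p r \<union> closed_segment r q \<union> closed_segment q s \<union> closed_segment s p"
    proof -
      have "{..<length ?vs} = {0, Suc 0, Suc (Suc 0), Suc (Suc (Suc 0))}" by auto
      then show ?thesis unfolding polygon_boundary_def edge_def by (simp add: nth Un_ac)
    qed
    have "polygon_boundary ?vs \<subseteq> ?T"
    proof -
      have "closed_segment a b \<subseteq> convex hull {x, y, z}" if "a \<in> {x,y,z}" "b \<in> {x,y,z}" for a b x y z :: "real \<times> real"
        using that by (simp add: segment_convex_hull) (rule hull_mono, auto)
      then have "closed_segment p r \<subseteq> convex hull {p, q, r}" "closed_segment r q \<subseteq> convex hull {p, q, r}"
        "closed_segment q s \<subseteq> convex hull {p, q, s}" "closed_segment s p \<subseteq> convex hull {p, q, s}"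
        by blast+
      then show ?thesis unfolding B by blast
    qed
    \<comment> \<open>Both triangles are convex and contain \<open>p\<close>, so their union is
      star-shaped about \<open>p\<close>.\<close>
    moreover have "closed_segment p y \<subseteq> ?T" if "y \<in> ?T" for y
    proof -
      have "closed_segment p y \<subseteq> convex hull {p, q, x}" if "y \<in> convex hull {p, q, x}" for x
        using that by (intro closed_segment_subset) (auto simp: hull_inc)
      then show ?thesis using that by blast
    qed
    ultimately have "inside (polygon_boundary ?vs) \<subseteq> ?T"
      by (intro inside_subset_starlike[of _ p]) (auto simp: hull_inc)
    moreover have "?T \<inter> grid m \<subseteq> {p, q, r, s}"
      using unimodular_triangle_Int_grid[OF G(1,2,3)] unimodular_triangle_Int_grid[OF G(1,2,4)] r s
      by auto
    moreover have "{p, q, r, s} \<subseteq> polygon_boundary ?vs" unfolding B by auto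
    moreover have "inside (polygon_boundary ?vs) \<inter> polygon_boundary ?vs = {}" by (rule inside_no_overlap)
    ultimately show ?thesis by blast
  qed
  ultimately show ?thesis using simple G by (simp add: is_prime_hole_def is_hole_def)
qed

section \<open>Vertices read off from the boundary, and finiteness\<close>

text \<open>Prime edges carry no grid points besides their endpoints. Equal boundary curves
  therefore have equal vertex sets, which is how holes are told apart when they are counted.\<close>

lemma polygon_boundary_Int_grid:
  assumes "is_prime_hole G k vs"
  shows "polygon_boundary vs \<inter> G = set vs"
proof -
  have k: "length vs = k" and vs: "vs \<noteq> []" and G: "set vs \<subseteq> G"
    using assms by (auto simp: is_prime_hole_def is_hole_def simple_polygon_def)
  have mem: "cyc_nth vs i \<in> set vs" for i using vs by (simp add: cyc_nth_def)
  have "edge vs i \<inter> G \<subseteq> set vs" if "i < k" for i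
  proof -
    let ?a = "cyc_nth vs i" and ?b = "cyc_nth vs (Suc i)"
    have "prime_segment G ?a ?b" using assms that by (simp add: is_prime_hole_def)
    then have "open_segment ?a ?b \<inter> G = {}"
      by (auto simp: prime_segment_def rel_interior_closed_segment split: if_splits)
    then show ?thesis using mem[of i] mem[of "Suc i"] by (auto simp: edge_def open_segment_def)
  qed
  moreover have "set vs \<subseteq> polygon_boundary vs"
  proof
    fix z assume "z \<in> set vs"
    then obtain i where "i < length vs" "z = cyc_nth vs i" by (auto simp: in_set_conv_nth cyc_nth_def)
    then show "z \<in> polygon_boundary vs" by (auto simp: polygon_boundary_def edge_def)
  qed
  ultimately show ?thesis using G unfolding polygon_boundary_def k by blast
qed

lemma finite_prime_holes: "finite (prime_holes (grid m) k)"
proof -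
  have "{vs. is_prime_hole (grid m) k vs} \<subseteq> {vs. set vs \<subseteq> grid m \<and> length vs = k}"
    by (auto simp: is_prime_hole_def is_hole_def)
  moreover have "finite (grid m)" by (simp add: grid_def)
  ultimately show ?thesis unfolding prime_holes_def
    using finite_lists_length_eq finite_subset by blast
qed

section \<open>A logarithmic lower bound for a totient sum\<close>

lemma sum_inverse_squares_le: "(\<Sum>g=1..N. 1 / (real g)\<^sup>2) \<le> 2"
proof -
  \<comment> \<open>The sharper bound makes the induction go through, by telescoping.\<close>
  have "(\<Sum>g=1..Suc N. 1 / (real g)\<^sup>2) \<le> 2 - 1 / real (Suc N)" for N
  proof (induction N)
    case (Suc N)
    have "1 / (real (Suc (Suc N)))\<^sup>2 \<le> 1 / real (Suc N) - 1 / real (Suc (Suc N))"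
    proof -
      have "1 / (x + 1)\<^sup>2 \<le> 1 / x - 1 / (x + 1)" if "x > 0" for x :: real
        using that by (simp add: divide_simps power2_eq_square)
      from this[of "real (Suc N)"] show ?thesis by (simp add: add.commute)
    qed
    then show ?case using Suc by simp
  qed simp
  from this[of "N - 1"] show ?thesis by (cases N) (auto intro: order_trans)
qed

text \<open>Since the totients of the divisors of \<open>n\<close> sum to \<open>n\<close>, the
  reciprocal of \<open>n\<close> is the sum of \<open>totient d / n\<^sup>2\<close> over
  \<open>d dvd n\<close>. With \<open>n = g * d\<close> each term splits into a factor in
  \<open>g\<close> and a factor in \<open>d\<close>.\<close>

lemma harm_le_sum_totient: "harm N \<le> 2 * (\<Sum>a=1..N. real (totient a) / (real a)\<^sup>2)"
proof -
  let ?S = "SIGMA n:{1..N}. {d. d dvd n}"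
  have fin: "finite {d. d dvd n}" if "n \<in> {1..N}" for n :: nat using that by simp
  have "harm N = (\<Sum>n=1..N. \<Sum>d | d dvd n. real (totient d) / (real n)\<^sup>2)"
  proof -
    have "inverse (real n) = (\<Sum>d | d dvd n. real (totient d) / (real n)\<^sup>2)" if "n \<in> {1..N}" for n
    proof -
      have "(\<Sum>d | d dvd n. real (totient d) / (real n)\<^sup>2) = real (\<Sum>d | d dvd n. totient d) / (real n)\<^sup>2"
        by (simp add: sum_divide_distrib)
      also have "\<dots> = inverse (real n)"
        using that unfolding totient_divisor_sum by (simp add: power2_eq_square divide_simps)
      finally show ?thesis by simp
    qed
    then show ?thesis unfolding harm_def by (intro sum.cong) auto
  qed
  also have "\<dots> = (\<Sum>(n, d)\<in>?S. real (totient d) / (real n)\<^sup>2)"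
    using fin by (subst sum.Sigma) auto
  \<comment> \<open>The pair \<open>(n, d)\<close> corresponds to \<open>g = n div d\<close>,
    \<open>a = d\<close>; pairs with \<open>g * a > N\<close> only add nonnegative terms.\<close>
  also have "\<dots> \<le> (\<Sum>(g, a)\<in>{1..N} \<times> {1..N}. 1 / (real g)\<^sup>2 * (real (totient a) / (real a)\<^sup>2))"
  proof (rule sum_le_included[where i = "\<lambda>(g, a). (g * a, a)"])
    show "finite ?S" using fin by (intro finite_SigmaI) auto
    show "\<forall>x\<in>?S. \<exists>y\<in>{1..N} \<times> {1..N}. (case y of (g, a) \<Rightarrow> (g * a, a)) = x \<and>
      (case x of (n, d) \<Rightarrow> real (totient d) / (real n)\<^sup>2)
      \<le> (case y of (g, a) \<Rightarrow> 1 / (real g)\<^sup>2 * (real (totient a) / (real a)\<^sup>2))"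
    proof
      fix x assume "x \<in> ?S"
      then obtain g d where gd: "x = (g * d, d)" "1 \<le> g * d" "g * d \<le> N" by (auto simp: mult.commute)
      have pos: "1 \<le> g" "1 \<le> d" using gd(2) by (auto intro: Suc_leI Nat.gr0I)
      have "g \<le> g * d" "d \<le> g * d" using pos by auto
      then have "g \<le> N" "d \<le> N" using gd(3) by linarith+
      with gd(1) pos show "\<exists>y\<in>{1..N} \<times> {1..N}. (case y of (g, a) \<Rightarrow> (g * a, a)) = x \<and>
      (case x of (n, d) \<Rightarrow> real (totient d) / (real n)\<^sup>2)
      \<le> (case y of (g, a) \<Rightarrow> 1 / (real g)\<^sup>2 * (real (totient a) / (real a)\<^sup>2))"
        by (intro bexI[of _ "(g, d)"]) (auto simp: power_mult_distrib)
    qed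
  qed (auto intro!: mult_nonneg_nonneg divide_nonneg_nonneg)
  also have "\<dots> = (\<Sum>g=1..N. 1 / (real g)\<^sup>2) * (\<Sum>a=1..N. real (totient a) / (real a)\<^sup>2)"
    unfolding sum_product by (simp add: sum.cartesian_product)
  also have "\<dots> \<le> 2 * (\<Sum>a=1..N. real (totient a) / (real a)\<^sup>2)"
    by (intro mult_right_mono sum_inverse_squares_le sum_nonneg) auto
  finally show ?thesis .
qed

section \<open>The family of holes and its size\<close>

text \<open>Take \<open>c\<close> as the residue of minus the inverse of \<open>b\<close> modulo
  \<open>a\<close>, so that \<open>a\<close> divides \<open>b * c + 1\<close>, and \<open>d\<close>
  as the quotient. The size bounds keep the vertices built from \<open>(c, d)\<close> inside the
  grid.\<close>

lemma ex_unimodular_complement: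
  fixes a b :: nat
  assumes "1 \<le> b" "b \<le> a" "coprime a b"
  shows "\<exists>c d. c < a \<and> 1 \<le> d \<and> d \<le> b \<and> a * d = b * c + 1"
proof -
  have "coprime (int b) (int a)" using assms by (simp add: coprime_commute)
  then obtain x where x: "[int b * x = 1] (mod int a)" using cong_solve_coprime_int by blast
  define c where "c = nat ((- x) mod int a)"
  have c: "int c = (- x) mod int a" "c < a"
    using assms by (simp_all add: c_def nat_less_iff)
  have "[int b * int c = int b * (- x)] (mod int a)"
    unfolding c by (intro cong_mult) (auto simp: cong_def)
  also have "[int b * (- x) = - 1] (mod int a)"
    using x by (metis cong_minus_minus_iff mult_minus_right)
  finally have "int a dvd int b * int c + 1" by (simp add: cong_iff_dvd_diff)
  also have "int b * int c + 1 = int (b * c + 1)" by simp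
  finally have "a dvd b * c + 1" by (simp only: int_dvd_int_iff)
  then obtain d where d: "b * c + 1 = a * d" by (elim dvdE)
  have "d \<ge> 1" using d by (cases d) auto
  have "a * d \<le> b * (a - 1) + b"
    unfolding d[symmetric] using c assms by (intro add_mono mult_le_mono) auto
  also have "\<dots> = a * b" using assms by (cases a) auto
  finally have "d \<le> b" using assms by simp
  with d c \<open>d \<ge> 1\<close> show ?thesis by metis
qed

text \<open>The leftmost vertex is \<open>p\<close> and the next one is \<open>q\<close>; the side
  of the line through them then distinguishes \<open>r\<close> from \<open>s\<close>.\<close>

lemma quadrilateral_eq_if_vertices_eq:
  assumes S: "{p, r, q, s} = {p', r', q', s'}"
    and "fst p < fst q" "fst q < fst r" "fst q < fst s"
    and "cross (q - p) (r - p) > 0" "cross (q - p) (s - p) < 0"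
    and "fst p' < fst q'" "fst q' < fst r'" "fst q' < fst s'"
    and "cross (q' - p') (r' - p') > 0" "cross (q' - p') (s' - p') < 0"
  shows "p = p' \<and> q = q' \<and> r = r' \<and> s = s'"
proof -
  have "p \<in> {p', r', q', s'}" "p' \<in> {p, r, q, s}" using S by auto
  then have p: "p = p'" using assms by auto
  have "q \<in> {p', r', q', s'}" "q' \<in> {p, r, q, s}" using S by auto
  then have q: "q = q'" using p assms by auto
  have "r \<in> {p', r', q', s'}" "s \<in> {p', r', q', s'}" using S by auto
  then show ?thesis using p q assms by auto
qed

text \<open>The factors count the \<open>b\<close> coprime to \<open>a\<close>, the positions of
  \<open>p\<close> in the lower left block of side \<open>h\<close>, and the pairs
  \<open>(k, l)\<close>. No vertex is more than \<open>h\<close> to the right of or above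
  \<open>p\<close>, so \<open>2 * h \<le> m\<close> leaves enough room.\<close>

lemma card_prime_holes_ge_sum_totient:
  assumes "2 * h \<le> m"
  shows "(\<Sum>a=1..h div 6. totient a * (h\<^sup>2 * (h div a - 2)\<^sup>2)) \<le> card (prime_holes (grid m) 4)"
proof -
  obtain c d :: "nat \<Rightarrow> nat \<Rightarrow> nat" where
    cd: "\<And>a b. 1 \<le> b \<Longrightarrow> b \<le> a \<Longrightarrow> coprime a b \<Longrightarrow>
      c a b < a \<and> 1 \<le> d a b \<and> d a b \<le> b \<and> a * d a b = b * c a b + 1"
  proof -
    define Q where "Q a b e \<longleftrightarrow> fst e < a \<and> 1 \<le> snd e \<and> snd e \<le> b \<and> a * snd e = b * fst e + 1"
      for a b :: nat and e :: "nat \<times> nat"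
    have "Q a b (SOME e. Q a b e)" if "1 \<le> b" "b \<le> a" "coprime a b" for a b
      using ex_unimodular_complement[OF that] by (intro someI_ex[of "Q a b"]) (simp add: Q_def)
    then show thesis
      by (intro that[of "\<lambda>a b. fst (SOME e. Q a b e)" "\<lambda>a b. snd (SOME e. Q a b e)"])
        (simp add: Q_def)
  qed
  \<comment> \<open>The upper bound on \<open>k\<close> and \<open>l\<close> gives
    \<open>(k + 1) * a \<le> h\<close>, which leaves room for adding \<open>w\<close>; the lower
    bound 2 puts \<open>r\<close> and \<open>s\<close> to the right of \<open>q\<close>.\<close>
  define T where "T = (SIGMA a:{1..h div 6}. totatives a \<times> ({1..h} \<times> {1..h}) \<times>
    ({2..h div a - 1} \<times> {2..h div a - 1}))"
  \<comment> \<open>In cyclic order: \<open>p\<close>, \<open>p + w + k v\<close>,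
    \<open>p + v\<close>, \<open>p - w + l v\<close>, with \<open>v = (a, b)\<close> and
    \<open>w = (c a b, d a b)\<close>.\<close>
  define vs where "vs = (\<lambda>(a, b, (x, y), (k, l)).
    [(real x, real y), (real x + real (c a b) + real k * real a, real y + real (d a b) + real k * real b),
     (real x + real a, real y + real b),
     (real x + real l * real a - real (c a b), real y + real l * real b - real (d a b))])"
  \<comment> \<open>The inequalities order the vertices by first coordinate and the equation is the
    determinant of \<open>v\<close> and \<open>w\<close>; both serve to recover the parameters from
    the vertex set.\<close>
  have T: "is_prime_hole (grid m) 4 (vs (a, b, (x, y), (k, l)))"
      "1 \<le> a" "real a < real (c a b) + real a * real k" "real a + real (c a b) < real a * real l"
      "real a * real (d a b) = real b * real (c a b) + 1"
    if t: "(a, b, (x, y), (k, l)) \<in> T" for a b x y k l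
  proof -
    have ab: "1 \<le> a" "1 \<le> b" "b \<le> a" "coprime a b" and xy: "1 \<le> x" "x \<le> h" "1 \<le> y" "y \<le> h"
      and kl: "2 \<le> k" "k + 1 \<le> h div a" "2 \<le> l" "l + 1 \<le> h div a"
      using t by (auto simp: T_def totatives_def coprime_commute)
    note c = cd[OF ab(2-4)]
    show "1 \<le> a" by (rule ab)
    have "real a * 2 \<le> real a * real k" "real a * 2 \<le> real a * real l"
      using kl by (intro mult_left_mono; simp)+
    then show "real a < real (c a b) + real a * real k" "real a + real (c a b) < real a * real l"
      using c ab by linarith+
    have "real (a * d a b) = real (b * c a b + 1)" using c by simp
    then show det: "real a * real (d a b) = real b * real (c a b) + 1" by simp
    have ka: "(k + 1) * a \<le> h" "(l + 1) * a \<le> h" using kl ab by (simp_all add: less_eq_div_iff_mult_less_eq)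
    moreover have "(k + 1) * b \<le> (k + 1) * a" "(l + 1) * b \<le> (l + 1) * a" using ab by (intro mult_le_mono; simp)+
    ultimately have kb: "(k + 1) * b \<le> h" "(l + 1) * b \<le> h" by linarith+
    have "1 * a \<le> l * a" "1 * b \<le> l * b" using kl by (intro mult_le_mono; simp)+
    then have cl: "c a b \<le> l * a" "d a b \<le> l * b" using c by linarith+
    let ?p = "(real x, real y)" and ?q = "(real x + real a, real y + real b)"
      and ?r = "(real x + real (c a b) + real k * real a, real y + real (d a b) + real k * real b)"
      and ?s = "(real x + real l * real a - real (c a b), real y + real l * real b - real (d a b))"
    note bounds = xy assms ka kb ab c cl
    have p: "?p \<in> grid m"
      by (rule in_gridI[of _ x _ y]) (use bounds in auto)
    have q: "?q \<in> grid m"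
      by (rule in_gridI[of _ "x + a" _ "y + b"]) (use bounds in auto)
    have r: "?r \<in> grid m"
      by (rule in_gridI[of _ "x + c a b + k * a" _ "y + d a b + k * b"]) (use bounds in auto)
    have s: "?s \<in> grid m"
      by (rule in_gridI[of _ "x + l * a - c a b" _ "y + l * b - d a b"])
        (use bounds in \<open>auto simp: of_nat_diff\<close>)
    have "cross (?r - ?p) (?s - ?p) = - (real k + real l) * (real a * real (d a b) - real b * real (c a b))"
      "cross (?r - ?q) (?s - ?q) = (2 - real k - real l) * (real a * real (d a b) - real b * real (c a b))"
      by (simp_all add: cross_def algebra_simps)
    moreover have "real k + real l \<noteq> 0" "2 - real k - real l \<noteq> 0" using kl by linarith+
    ultimately have "cross (?r - ?p) (?s - ?p) \<noteq> 0" "cross (?r - ?q) (?s - ?q) \<noteq> 0"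
      using det by simp_all
    moreover have "cross (?q - ?p) (?r - ?p) = 1" "cross (?q - ?p) (?s - ?p) = -1"
      using det by (simp_all add: cross_def algebra_simps)
    ultimately show "is_prime_hole (grid m) 4 (vs (a, b, (x, y), (k, l)))"
      unfolding vs_def prod.case by (intro is_prime_hole_quadrilateral p q r s)
  qed
  have "inj_on (\<lambda>t. polygon_boundary (vs t)) T"
  proof (rule inj_onI)
    fix t t' assume t: "t \<in> T" "t' \<in> T" and eq: "polygon_boundary (vs t) = polygon_boundary (vs t')"
    obtain a b x y k l a' b' x' y' k' l' where
      t_def: "t = (a, b, (x, y), (k, l))" and t'_def: "t' = (a', b', (x', y'), (k', l'))"
      by (metis prod.collapse)
    note T1 = T[OF t(1)[unfolded t_def]] and T2 = T[OF t(2)[unfolded t'_def]]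
    have set: "set (vs t) = set (vs t')"
      using polygon_boundary_Int_grid[OF T1(1)] polygon_boundary_Int_grid[OF T2(1)] eq
      unfolding t_def t'_def by simp
    have *: "(real x, real y) = (real x', real y') \<and> (real x + real a, real y + real b) = (real x' + real a', real y' + real b') \<and>
       (real x + real (c a b) + real k * real a, real y + real (d a b) + real k * real b) =
       (real x' + real (c a' b') + real k' * real a', real y' + real (d a' b') + real k' * real b') \<and>
       (real x + real l * real a - real (c a b), real y + real l * real b - real (d a b)) =
       (real x' + real l' * real a' - real (c a' b'), real y' + real l' * real b' - real (d a' b'))"
      by (rule quadrilateral_eq_if_vertices_eq)
        (use set T1(2-) T2(2-) in \<open>simp_all add: t_def t'_def vs_def cross_def algebra_simps\<close>)
    \<comment> \<open>Once \<open>a\<close> and \<open>b\<close> agree, so does the chosen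
      \<open>w\<close>, and \<open>k\<close>, \<open>l\<close> follow on cancelling
      \<open>a > 0\<close>.\<close>
    then have "x = x'" "y = y'" "a = a'" "b = b'" by auto
    then show "t = t'" using * T1(2) by (simp add: t_def t'_def)
  qed
  then have "card T = card ((\<lambda>t. polygon_boundary (vs t)) ` T)" by (simp add: card_image)
  also have "\<dots> \<le> card (prime_holes (grid m) 4)"
    by (rule card_mono[OF finite_prime_holes]) (use T(1) in \<open>force simp: prime_holes_def\<close>)
  also have "card T = (\<Sum>a=1..h div 6. totient a * (h\<^sup>2 * (h div a - 2)\<^sup>2))"
  proof -
    have "card {2..j - 1} = j - 2" for j :: nat by simp
    then show ?thesis
      unfolding T_def by (simp add: card_SigmaI card_cartesian_product totient_def power2_eq_square)
  qed
  finally show ?thesis .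
qed

section \<open>From the totient sum to the asymptotic bound\<close>

lemma card_prime_holes_ge:
  assumes "2 * h \<le> m"
  shows "real h ^ 4 / 8 * ln (real (h div 6) + 1) \<le> real (card (prime_holes (grid m) 4))"
proof -
  have "real h ^ 4 / 8 * ln (real (h div 6) + 1) \<le> real h ^ 4 / 8 * harm (h div 6)"
    using ln_le_harm[of "h div 6"] by (intro mult_left_mono) auto
  also have "\<dots> \<le> real h ^ 4 / 8 * (2 * (\<Sum>a=1..h div 6. real (totient a) / (real a)\<^sup>2))"
    by (intro mult_left_mono harm_le_sum_totient) auto
  also have "\<dots> = (\<Sum>a=1..h div 6. real (totient a) * ((real h)\<^sup>2 * (real h / (2 * real a))\<^sup>2))"
    by (simp add: sum_distrib_left power_divide power_mult_distrib field_simps flip: power_add)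
  also have "\<dots> \<le> (\<Sum>a=1..h div 6. real (totient a) * ((real h)\<^sup>2 * (real (h div a - 2))\<^sup>2))"
  proof (intro sum_mono mult_left_mono power_mono)
    fix a assume a: "a \<in> {1..h div 6}"
    then have "a * 6 \<le> h" by (simp add: less_eq_div_iff_mult_less_eq)
    then have h6: "6 \<le> h div a" using a by (simp add: less_eq_div_iff_mult_less_eq mult.commute)
    have "h < a * (h div a + 1)" using a by (simp add: dividend_less_times_div)
    then have "real h < real (a * (h div a + 1))" by (simp only: of_nat_less_iff)
    then have "real h / real a < real (h div a) + 1" using a by (simp add: field_simps)
    moreover have "real h / real a \<ge> 6" using \<open>a * 6 \<le> h\<close> a
      by (simp add: field_simps)
    \<comment> \<open>With \<open>u = h / a\<close> at least 6, the floor of \<open>u\<close> minus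
      2 exceeds \<open>u - 3\<close>, which is at least \<open>u / 2\<close>. This is the reason for
      the cutoff \<open>h div 6\<close>.\<close>
    ultimately show "real h / (2 * real a) \<le> real (h div a - 2)" using h6 by (simp add: of_nat_diff)
  qed auto
  also have "\<dots> = real (\<Sum>a=1..h div 6. totient a * (h\<^sup>2 * (h div a - 2)\<^sup>2))" by simp
  also have "\<dots> \<le> real (card (prime_holes (grid m) 4))"
    using card_prime_holes_ge_sum_totient[OF assms] by (simp only: of_nat_le_iff)
  finally show ?thesis .
qed

theorem theorem6:
  shows "(\<lambda>m::nat. real (card (prime_holes (grid m) 4)))
    \<in> \<Omega>(\<lambda>m. let n = real (m\<^sup>2) in n\<^sup>2 * ln n / ln (ln n))"
proof -
  \<comment> \<open>Here \<open>n\<^sup>2 * ln n\<close> is \<open>2 * m ^ 4 * ln m\<close>, and the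
    divisor \<open>ln (ln n)\<close> tends to infinity.\<close>
  have "(\<lambda>m::nat. (real m / 4) ^ 4 / 8 * ln (real m / 24)) \<in> \<Omega>(\<lambda>m. let n = real (m\<^sup>2) in n\<^sup>2 * ln n / ln (ln n))"
    unfolding Let_def of_nat_power by real_asymp
  moreover have "(\<lambda>m. real (card (prime_holes (grid m) 4))) \<in> \<Omega>(\<lambda>m::nat. (real m / 4) ^ 4 / 8 * ln (real m / 24))"
  proof (rule landau_omega.bigI[of 1])
    show "\<forall>\<^sub>F m in sequentially. norm (real (card (prime_holes (grid m) 4))) \<ge>
       1 * norm ((real m / 4) ^ 4 / 8 * ln (real m / 24))"
      using eventually_ge_at_top[of 24]
    proof eventually_elim
      case (elim m)
      define h where "h = m div 2"
      \<comment> \<open>The constants 4 and 24 are generous enough to absorb the rounding in both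
        divisions.\<close>
      have h: "2 * h \<le> m" "real m / 4 \<le> real h" "real m / 24 \<le> real (h div 6) + 1"
        using elim unfolding h_def by linarith+
      have "(real m / 4) ^ 4 / 8 * ln (real m / 24) \<le> real h ^ 4 / 8 * ln (real (h div 6) + 1)"
        using h elim by (intro mult_mono divide_right_mono power_mono) auto
      also note card_prime_holes_ge[OF h(1)]
      finally show ?case using elim by simp
    qed
  qed simp
  ultimately show ?thesis by (rule landau_omega.big_trans[rotated])
qed

end
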